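(* Let $P:\mathbb{R}^n\times\mathbb{R}^m\to\mathbb{R}\cup\{\infty\}$ be proper and lower semicontinuous, with $P(x,z)$ level-bounded in $z$ locally uniformly in $x$, and let $p(x):=\inf_{z\in\mathbb{R}^m}P(x,z)$. Let $\varepsilon\ge 0$ be fixed. Then, relative to the minimization of $p$, any $\varepsilon$-M-stationary point is also $\varepsilon$-$\Upsilon$-stationary.
   Context: $P(x,z)$ is level-bounded in $z$ locally uniformly in $x$ if for each $\alpha\in\mathbb{R}$ and $\bar x\in\mathbb{R}^n$ there is $\delta>0$ such that $\{(x,z): P(x,z)\le\alpha,\ \|x-\bar x\|\le\delta\}$ is bounded. For a proper lsc $h$: the regular subdifferential is given by $v\in\hat\partial h(\bar x)$ iff $\liminf_{x\to\bar x,x\ne\bar x}\frac{h(x)-h(\bar x)-\langle v,x-\bar x\rangle}{\|x-\bar x\|}\ge0$; the limiting subdifferential by $v\in\partial h(\bar x)$ iff $\bar x\in\operatorname{dom}h$ and there are $x^k\to\bar x$ with $h(x^k)\to h(\bar x)$ and $v^k\in\hat\partial h(x^k)$ with $v^k\to v$. A point $x^\ast\in\operatorname{dom}h$ is $\varepsilon$-M-stationary for the minimization of $h$ if $\operatorname{dist}(0,\partial h(x^\ast))\le\varepsilon$ (the distance to the empty set being $\infty$). Let $\mathbf{O}(x):=\operatorname{argmin}_{z\in\mathbb{R}^m}P(x,z)$ and $\Upsilon(x):=\bigcup_{z\in\mathbf{O}(x)}\{v\in\mathbb{R}^n:(v,0)\in\partial P(x,z)\}$. A point $x^\ast\in\operatorname{dom}p$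 is $\varepsilon$-$\Upsilon$-stationary relative to $p$ if $\operatorname{dist}(0,\Upsilon(x^\ast))\le\varepsilon$. *)

theory Defs
  imports "HOL-Analysis.Analysis"
begin

definition edom :: "('a \<Rightarrow> ereal) \<Rightarrow> 'a set" where
  "edom h = {x. h x < \<infinity>}"

definition proper_fun :: "('a \<Rightarrow> ereal) \<Rightarrow> bool" where
  "proper_fun h \<longleftrightarrow> (\<forall>x. h x > -\<infinity>) \<and> edom h \<noteq> {}"

definition lsc :: "('a::topological_space \<Rightarrow> ereal) \<Rightarrow> bool" where
  "lsc h \<longleftrightarrow> (\<forall>x0. h x0 \<le> Liminf (nhds x0) h)"

definition level_bounded_locally_uniformly ::
  "('a::euclidean_space \<times> 'b::euclidean_space \<Rightarrow> ereal) \<Rightarrow> bool" where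
  "level_bounded_locally_uniformly P \<longleftrightarrow>
     (\<forall>\<alpha>::real. \<forall>x0. \<exists>\<delta>>0. bounded {(x, z). P (x, z) \<le> ereal \<alpha> \<and> norm (x - x0) \<le> \<delta>})"

text \<open>The regular subdifferential is empty outside the domain. The restriction is needed because
  the difference of \<open>\<infinity>\<close> with itself is \<open>\<infinity>\<close> in \<^typ>\<open>ereal\<close>, so the difference quotient alone
  would admit every vector at interior points of the complement of the domain.
  The punctured neighbourhood \<open>x \<noteq> x0\<close> is built into the filter \<open>at x0\<close>.\<close>

definition regular_subdiff :: "('a::euclidean_space \<Rightarrow> ereal) \<Rightarrow> 'a \<Rightarrow> 'a set" where
  "regular_subdiff h x0 =
     {v. x0 \<in> edom h \<and>
         Liminf (at x0) (\<lambda>x. (h x - h x0 - ereal (v \<bullet> (x - x0))) / ereal (norm (x - x0))) \<ge> 0}"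

definition limiting_subdiff :: "('a::euclidean_space \<Rightarrow> ereal) \<Rightarrow> 'a \<Rightarrow> 'a set" where
  "limiting_subdiff h x0 =
     {v. x0 \<in> edom h \<and>
         (\<exists>xs vs. xs \<longlonglongrightarrow> x0 \<and> (\<lambda>k. h (xs k)) \<longlonglongrightarrow> h x0 \<and>
                  (\<forall>k::nat. vs k \<in> regular_subdiff h (xs k)) \<and> vs \<longlonglongrightarrow> v)}"

text \<open>Unlike \<^const>\<open>infdist\<close>, which is 0 for the empty set, this distance is \<open>\<infinity>\<close> there.\<close>

definition edist_set :: "'a::metric_space \<Rightarrow> 'a set \<Rightarrow> ereal" where
  "edist_set x S = (INF y\<in>S. ereal (dist x y))"

definition M_stationary :: "real \<Rightarrow> ('a::euclidean_space \<Rightarrow> ereal) \<Rightarrow> 'a \<Rightarrow> bool" where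
  "M_stationary \<epsilon> h x \<longleftrightarrow> x \<in> edom h \<and> edist_set 0 (limiting_subdiff h x) \<le> ereal \<epsilon>"

definition marginal :: "('a \<times> 'b \<Rightarrow> ereal) \<Rightarrow> 'a \<Rightarrow> ereal" where
  "marginal P x = (INF z. P (x, z))"

definition argmin_map :: "('a \<times> 'b \<Rightarrow> ereal) \<Rightarrow> 'a \<Rightarrow> 'b set" where
  "argmin_map P x = {z. is_arg_min (\<lambda>z. P (x, z)) (\<lambda>_. True) z}"

definition Upsilon :: "('a::euclidean_space \<times> 'b::euclidean_space \<Rightarrow> ereal) \<Rightarrow> 'a \<Rightarrow> 'a set" where
  "Upsilon P x = (\<Union>z\<in>argmin_map P x. {v. (v, 0) \<in> limiting_subdiff P (x, z)})"

definition Upsilon_stationary ::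
  "real \<Rightarrow> ('a::euclidean_space \<times> 'b::euclidean_space \<Rightarrow> ereal) \<Rightarrow> 'a \<Rightarrow> bool" where
  "Upsilon_stationary \<epsilon> P x \<longleftrightarrow>
     x \<in> edom (marginal P) \<and> edist_set 0 (Upsilon P x) \<le> ereal \<epsilon>"

end

theory Submission
  imports Defs
begin

text \<open>
  The heart of the matter is the inclusion \<open>limiting_subdiff (marginal P) x \<subseteq> Upsilon P x\<close>; passing
  to a larger set can only decrease the distance from the origin.

  At the level of regular subgradients the inclusion is elementary. If \<open>z\<close> minimizes \<open>P (x, \<cdot>)\<close>,
  then \<open>P\<close> dominates \<open>marginal P\<close> everywhere and agrees with it at \<open>(x, z)\<close>, so an approximate
  affine minorant of \<open>marginal P\<close> at \<open>x\<close> with slope \<open>v\<close> is, read as a function of both variables,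
  an approximate affine minorant of \<open>P\<close> at \<open>(x, z)\<close> with slope \<open>(v, 0)\<close>
  (\<open>regular_subdiff_marginal_lift\<close>).

  To pass to limits, the minimizers have to be carried along a sequence \<open>xs \<longlonglongrightarrow> x\<close>. Level
  boundedness keeps them in a bounded set, so a subsequence converges, and lower semicontinuity
  bounds the value of \<open>P\<close> at the limit by the limit of the values
  (\<open>level_bounded_subsequence\<close>). The same compactness argument along the constant sequence \<open>x\<close>
  shows that minimizers exist at all. Since the values \<open>marginal P (xs k)\<close> converge to
  \<open>marginal P x\<close>, the limit point is itself a minimizer and the values of \<open>P\<close> converge along the
  subsequence, which is exactly what a limiting subgradient of \<open>P\<close> requires.
\<close>

text \<open>With a finite value at the base point, the difference quotient is honest real arithmetic except
  for a possibly infinite \<open>h y\<close>, so the inequality can be cleared of denominators. In this form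
  it is monotone in \<open>h\<close>, which is what comparing \<open>P\<close> with its marginal needs.\<close>

lemma regular_subdiff_iff_approx_minorant:
  fixes h :: "'a::euclidean_space \<Rightarrow> ereal"
  assumes a: "h x0 = ereal a"
  shows "v \<in> regular_subdiff h x0 \<longleftrightarrow>
    (\<forall>e>0. \<forall>\<^sub>F y in at x0. ereal (a + v \<bullet> (y - x0) - e * norm (y - x0)) < h y)"
proof -
  let ?q = "\<lambda>y. (h y - h x0 - ereal (v \<bullet> (y - x0))) / ereal (norm (y - x0))"
  have quotient: "ereal (- e) < ?q y \<longleftrightarrow>
      ereal (a + v \<bullet> (y - x0) - e * norm (y - x0)) < h y" if "y \<noteq> x0" for e y
  proof -
    have n: "norm (y - x0) > 0" using that by simp
    show ?thesis
    proof (cases "h y")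
      case (real r)
      show ?thesis using n by (auto simp: real a field_simps)
    qed (use n in \<open>auto simp: a\<close>)
  qed
  have "v \<in> regular_subdiff h x0 \<longleftrightarrow> (\<forall>c<0. \<forall>\<^sub>F y in at x0. c < ?q y)"
    by (simp add: regular_subdiff_def edom_def a le_Liminf_iff)
  also have "\<dots> \<longleftrightarrow> (\<forall>e>0. \<forall>\<^sub>F y in at x0. ereal (- e) < ?q y)"
  proof (intro iffI allI impI)
    fix e :: real
    assume "\<forall>c<0. \<forall>\<^sub>F y in at x0. c < ?q y" "e > 0"
    then show "\<forall>\<^sub>F y in at x0. ereal (- e) < ?q y" by (auto simp del: uminus_ereal.simps)
  next
    fix c :: ereal
    assume *: "\<forall>e>0. \<forall>\<^sub>F y in at x0. ereal (- e) < ?q y" and "c < 0"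
    then obtain r where r: "c < ereal r" "ereal r < 0" using ereal_dense2 by blast
    then have "\<forall>\<^sub>F y in at x0. ereal r < ?q y" using *[rule_format, of "- r"] by simp
    then show "\<forall>\<^sub>F y in at x0. c < ?q y" by eventually_elim (use r in order)
  qed
  also have "\<dots> \<longleftrightarrow> (\<forall>e>0. \<forall>\<^sub>F y in at x0.
      ereal (a + v \<bullet> (y - x0) - e * norm (y - x0)) < h y)"
    by (intro all_cong eventually_cong) (auto simp: eventually_at_filter quotient)
  finally show ?thesis .
qed

lemma marginal_le: "marginal P x \<le> P (x, z)"
  unfolding marginal_def by (rule INF_lower) simp

lemma argmin_map_iff: "z \<in> argmin_map P x \<longleftrightarrow> P (x, z) = marginal P x"
proof
  assume "z \<in> argmin_map P x"
  then have "P (x, z) \<le> P (x, w)" for w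
    by (auto simp: argmin_map_def is_arg_min_def not_less)
  then show "P (x, z) = marginal P x"
    by (auto simp: marginal_def intro!: antisym INF_greatest INF_lower)
next
  assume "P (x, z) = marginal P x"
  then show "z \<in> argmin_map P x"
    using marginal_le[of P x] by (auto simp: argmin_map_def is_arg_min_def not_less)
qed

lemma lsc_sequentially_le:
  fixes h :: "'a::first_countable_topology \<Rightarrow> ereal"
  assumes "lsc h" "xs \<longlonglongrightarrow> x" "c \<longlonglongrightarrow> c0" "\<And>k. h (xs k) \<le> c k"
  shows "h x \<le> c0"
proof (rule ccontr)
  assume "\<not> h x \<le> c0"
  then obtain b where b: "c0 < b" "b < h x" using dense not_le by metis
  have "b < Liminf (nhds x) h" using assms(1) b by (auto simp: lsc_def intro: less_le_trans)
  then have "\<forall>\<^sub>F y in nhds x. b < h y" by (rule less_LiminfD)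
  then have "\<forall>\<^sub>F k in sequentially. b < h (xs k)"
    using assms(2) by (auto simp: filterlim_iff)
  moreover have "\<forall>\<^sub>F k in sequentially. c k < b"
    using assms(3) b(1) by (rule order_tendstoD)
  ultimately have "\<forall>\<^sub>F k in sequentially. False"
    by eventually_elim (use assms(4) in \<open>meson less_le_trans less_asym\<close>)
  then show False by simp
qed

text \<open>A compactness principle for points with controlled values. Only the bound \<open>c k\<close> has to
  converge, so it serves both for minimizing sequences over a fixed \<open>x0\<close> and for minimizers over a
  moving base point.\<close>

lemma level_bounded_subsequence:
  fixes P :: "'a::euclidean_space \<times> 'b::euclidean_space \<Rightarrow> ereal"
  assumes lsc: "lsc P" and lb: "level_bounded_locally_uniformly P"
    and xs: "xs \<longlonglongrightarrow> x0" and c: "c \<longlonglongrightarrow> c0" and fin: "c0 < \<infinity>"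
    and le: "\<And>k. P (xs k, zs k) \<le> c k"
  obtains z r where "strict_mono (r :: nat \<Rightarrow> nat)" "(zs \<circ> r) \<longlonglongrightarrow> z" "P (x0, z) \<le> c0"
proof -
  obtain \<alpha> where \<alpha>: "c0 < ereal \<alpha>" using fin ereal_dense2 by blast
  obtain \<delta> where \<delta>: "\<delta> > 0" and
    bdd: "bounded {(x, z). P (x, z) \<le> ereal \<alpha> \<and> norm (x - x0) \<le> \<delta>}" (is "bounded ?S")
    using lb unfolding level_bounded_locally_uniformly_def by blast
  have "\<forall>\<^sub>F k in sequentially. c k < ereal \<alpha>"
    using c \<alpha> by (rule order_tendstoD)
  moreover have "\<forall>\<^sub>F k in sequentially. dist (xs k) x0 < \<delta>"
    using xs \<delta> by (rule tendstoD)
  ultimately have "\<forall>\<^sub>F k in sequentially. (xs k, zs k) \<in> ?S"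
    by eventually_elim
      (use le in \<open>auto simp: dist_norm intro: order.strict_implies_order le_less_trans\<close>)
  then obtain N where N: "\<And>k. k \<ge> N \<Longrightarrow> (xs k, zs k) \<in> ?S"
    by (auto simp: eventually_sequentially)
  have "bounded (snd ` ?S)" using bdd by (rule bounded_snd)
  moreover have "range (\<lambda>k. zs (k + N)) \<subseteq> snd ` ?S"
  proof safe
    fix k show "zs (k + N) \<in> snd ` ?S"
      using N[of "k + N"] by (intro image_eqI[of _ _ "(xs (k + N), zs (k + N))"]) auto
  qed
  ultimately have "bounded (range (\<lambda>k. zs (k + N)))" by (rule bounded_subset)
  then obtain z s where s: "strict_mono (s :: nat \<Rightarrow> nat)" "((\<lambda>k. zs (k + N)) \<circ> s) \<longlonglongrightarrow> z"
    using bounded_imp_convergent_subsequence by blast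
  define r where "r = (\<lambda>k. s k + N)"
  have r: "strict_mono r" using s(1) by (auto simp: r_def strict_mono_def)
  have zr: "(zs \<circ> r) \<longlonglongrightarrow> z" using s(2) by (simp add: r_def o_def)
  have "(\<lambda>k. (xs (r k), zs (r k))) \<longlonglongrightarrow> (x0, z)"
    using LIMSEQ_subseq_LIMSEQ[OF xs r] zr by (auto simp: o_def intro: tendsto_Pair)
  moreover have "(\<lambda>k. c (r k)) \<longlonglongrightarrow> c0"
    using LIMSEQ_subseq_LIMSEQ[OF c r] by (simp add: o_def)
  ultimately have "P (x0, z) \<le> c0"
    using lsc_sequentially_le[OF lsc] le by blast
  with r zr show thesis by (rule that)
qed

lemma argmin_map_nonempty:
  fixes P :: "'a::euclidean_space \<times> 'b::euclidean_space \<Rightarrow> ereal"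
  assumes "lsc P" "level_bounded_locally_uniformly P" "x \<in> edom (marginal P)"
  shows "argmin_map P x \<noteq> {}"
proof -
  obtain c where c: "\<And>k. c k \<in> range (\<lambda>z. P (x, z))" "c \<longlonglongrightarrow> marginal P x"
    unfolding marginal_def using Inf_as_limit[of "range (\<lambda>z. P (x, z))"] by auto
  then have "\<forall>k. \<exists>z. P (x, z) = c k" by (metis imageE)
  then obtain zs where "\<And>k. P (x, zs k) = c k" by metis
  then have le: "P (x, zs k) \<le> c k" for k by simp
  have "marginal P x < \<infinity>" using assms(3) by (simp add: edom_def)
  then obtain z where "P (x, z) \<le> marginal P x"
    using level_bounded_subsequence[OF assms(1,2) tendsto_const c(2) _ le] by blast
  then show ?thesis
    using marginal_le[of P x z] by (auto simp: argmin_map_iff intro: antisym)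
qed

text \<open>The increment of the first variable is no longer than that of the pair, so the error term
  only grows when it is measured in the product space. Points \<open>(x, w)\<close> with \<open>w \<noteq> z\<close> need
  separate care: they belong to punctured neighbourhoods of \<open>(x, z)\<close> but project onto \<open>x\<close> itself.
  There minimality of \<open>z\<close> gives the minorant, and the increment in \<open>w\<close> makes it strict.\<close>

lemma regular_subdiff_marginal_lift:
  fixes P :: "'a::euclidean_space \<times> 'b::euclidean_space \<Rightarrow> ereal"
  assumes proper: "proper_fun P" and z: "z \<in> argmin_map P x"
    and v: "v \<in> regular_subdiff (marginal P) x"
  shows "(v, 0) \<in> regular_subdiff P (x, z)"
proof -
  have eq: "P (x, z) = marginal P x" using z by (simp add: argmin_map_iff)
  have "P (x, z) > -\<infinity>" using proper by (simp add: proper_fun_def)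
  moreover have "marginal P x < \<infinity>" using v by (simp add: regular_subdiff_def edom_def)
  ultimately obtain a where a: "marginal P x = ereal a"
    using eq by (cases "marginal P x") auto
  show ?thesis
  proof (subst regular_subdiff_iff_approx_minorant)
    show "P (x, z) = ereal a" using eq a by simp
    show "\<forall>e>0. \<forall>\<^sub>F y in at (x, z).
      ereal (a + (v, 0) \<bullet> (y - (x, z)) - e * norm (y - (x, z))) < P y"
    proof (intro allI impI)
      fix e :: real assume e: "e > 0"
      let ?m = "\<lambda>y. ereal (a + v \<bullet> (y - x) - e * norm (y - x))"
      have "\<forall>\<^sub>F y in at x. ?m y < marginal P y"
        using v e regular_subdiff_iff_approx_minorant[where h = "marginal P", OF a] by blast
      then have "\<forall>\<^sub>F y in nhds x. y \<noteq> x \<longrightarrow> ?m y < marginal P y"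
        by (simp add: eventually_at_filter)
      moreover have "filterlim fst (nhds x) (at (x, z))"
        using tendsto_fst[OF tendsto_ident_at[of "(x, z)" UNIV]] by simp
      ultimately have "\<forall>\<^sub>F y in at (x, z). fst y \<noteq> x \<longrightarrow> ?m (fst y) < marginal P (fst y)"
        by (rule eventually_compose_filterlim)
      moreover have "\<forall>\<^sub>F y in at (x, z). y \<noteq> (x, z)"
        by (simp add: eventually_at_filter)
      ultimately show "\<forall>\<^sub>F y in at (x, z).
        ereal (a + (v, 0) \<bullet> (y - (x, z)) - e * norm (y - (x, z))) < P y"
      proof eventually_elim
        case (elim y)
        obtain y1 y2 where y: "y = (y1, y2)" by (cases y)
        have norm: "norm (y1 - x) \<le> norm (y - (x, z))"
          using norm_fst_le[of "y1 - x" "y2 - z"] by (simp add: y)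
        show ?case
        proof (cases "y1 = x")
          case True
          have "0 < e * norm (y - (x, z))" using e elim(2) by simp
          then have "ereal (a + (v, 0) \<bullet> (y - (x, z)) - e * norm (y - (x, z))) < marginal P x"
            by (simp add: a y True)
          also have "\<dots> \<le> P y" unfolding y True by (rule marginal_le)
          finally show ?thesis .
        next
          case False
          have "ereal (a + (v, 0) \<bullet> (y - (x, z)) - e * norm (y - (x, z))) \<le> ?m y1"
            using norm e by (simp add: y)
          also have "\<dots> < marginal P y1" using elim(1) False by (simp add: y)
          also have "\<dots> \<le> P y" unfolding y by (rule marginal_le)
          finally show ?thesis .
        qed
      qed
    qed
  qed
qed

text \<open>Convergence of the values \<open>marginal P (xs k)\<close>, which is part of the definition of the limiting
  subdifferential, is used twice: it makes the limit of the minimizers a minimizer, and it is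
  the convergence of the values of \<open>P\<close> along the lifted sequence.\<close>

lemma limiting_subdiff_marginal_subset_Upsilon:
  fixes P :: "'a::euclidean_space \<times> 'b::euclidean_space \<Rightarrow> ereal"
  assumes proper: "proper_fun P" and lsc: "lsc P" and lb: "level_bounded_locally_uniformly P"
  shows "limiting_subdiff (marginal P) x \<subseteq> Upsilon P x"
proof
  fix v assume "v \<in> limiting_subdiff (marginal P) x"
  then obtain xs vs where x: "x \<in> edom (marginal P)" and xs: "xs \<longlonglongrightarrow> x"
    and p: "(\<lambda>k. marginal P (xs k)) \<longlonglongrightarrow> marginal P x"
    and reg: "\<And>k. vs k \<in> regular_subdiff (marginal P) (xs k)" and vs: "vs \<longlonglongrightarrow> v"
    by (auto simp: limiting_subdiff_def)
  have "xs k \<in> edom (marginal P)" for k using reg by (simp add: regular_subdiff_def)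
  then have "\<forall>k. \<exists>z. z \<in> argmin_map P (xs k)"
    using argmin_map_nonempty[OF lsc lb] by blast
  then obtain zs where zs: "\<And>k. zs k \<in> argmin_map P (xs k)" by metis
  then have val: "P (xs k, zs k) = marginal P (xs k)" for k by (simp add: argmin_map_iff)
  then have le: "P (xs k, zs k) \<le> marginal P (xs k)" for k by simp
  have "marginal P x < \<infinity>" using x by (simp add: edom_def)
  then obtain z r where r: "strict_mono (r :: nat \<Rightarrow> nat)" and zr: "(zs \<circ> r) \<longlonglongrightarrow> z"
    and "P (x, z) \<le> marginal P x"
    using level_bounded_subsequence[OF lsc lb xs p _ le] by blast
  then have eq: "P (x, z) = marginal P x" using marginal_le[of P x z] by simp
  have "(v, 0) \<in> limiting_subdiff P (x, z)"
    unfolding limiting_subdiff_def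
  proof (intro CollectI conjI exI allI)
    show "(x, z) \<in> edom P" using x eq by (simp add: edom_def)
    show "(\<lambda>k. (xs (r k), zs (r k))) \<longlonglongrightarrow> (x, z)"
      using LIMSEQ_subseq_LIMSEQ[OF xs r] zr by (auto simp: o_def intro: tendsto_Pair)
    show "(\<lambda>k. P (xs (r k), zs (r k))) \<longlonglongrightarrow> P (x, z)"
      using LIMSEQ_subseq_LIMSEQ[OF p r] by (simp add: o_def val eq)
    show "(vs (r k), 0) \<in> regular_subdiff P (xs (r k), zs (r k))" for k
      by (rule regular_subdiff_marginal_lift[OF proper zs reg])
    show "(\<lambda>k. (vs (r k), 0)) \<longlonglongrightarrow> (v, 0)"
      using LIMSEQ_subseq_LIMSEQ[OF vs r] by (auto simp: o_def intro: tendsto_Pair)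
  qed
  with eq show "v \<in> Upsilon P x" by (auto simp: Upsilon_def argmin_map_iff)
qed

lemma edist_set_antimono: "S \<subseteq> T \<Longrightarrow> edist_set x T \<le> edist_set x S"
  unfolding edist_set_def by (rule INF_superset_mono) auto

theorem proposition3p2:
  fixes P :: "(real ^ 'n) \<times> (real ^ 'm) \<Rightarrow> ereal"
    and \<epsilon> :: real
    and x :: "real ^ 'n"
  assumes "proper_fun P"
    and "lsc P"
    and "level_bounded_locally_uniformly P"
    and "\<epsilon> \<ge> 0"
    and "M_stationary \<epsilon> (marginal P) x"
  shows "Upsilon_stationary \<epsilon> P x"
  using assms(5)
    edist_set_antimono[OF limiting_subdiff_marginal_subset_Upsilon[OF assms(1-3)], of 0 x]
  unfolding M_stationary_def Upsilon_stationary_def by (auto intro: order_trans)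

end
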